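(* Let $\Lambda_2$ be the lattice with basis $e_1,e_2$ and Gram matrix $2\begin{pmatrix}2&-1\\-1&2\end{pmatrix}$. Every integral lattice $M$ in $\mathbb{R}\Lambda_2$ with $\Lambda_2\subseteq M$ is isometric to $\Lambda_2$ or to $\Lambda_2(\tfrac12 e_1)$.
   Context: A lattice is integral if all inner products of its vectors are integers. For a lattice $L$ and vectors $x_1,\dots,x_k$ in $\mathbb{R}L$, $L(x_1,\dots,x_k)$ denotes the lattice $\langle L,x_1,\dots,x_k\rangle$ generated by $L$ and the $x_i$. *)

theory Defs
  imports "HOL-Analysis.Analysis" "HOL-Computational_Algebra.Group_Closure"
begin

text \<open>
  Lattices live in an arbitrary real inner product space. The set \<open>group_closure S\<close> is the additive
  subgroup generated by \<open>S\<close>, i.e. its integer span, whereas \<open>span L\<close> is the real span \<open>\<real>L\<close>.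
\<close>

definition lattice_basis :: "'a::real_vector set \<Rightarrow> 'a set \<Rightarrow> bool" where
  "lattice_basis B L \<longleftrightarrow> finite B \<and> independent B \<and> L = group_closure B"

definition is_lattice :: "'a::real_vector set \<Rightarrow> bool" where
  "is_lattice L \<longleftrightarrow> (\<exists>B. lattice_basis B L)"

definition integral_lattice :: "'a::real_inner set \<Rightarrow> bool" where
  "integral_lattice L \<longleftrightarrow> is_lattice L \<and> (\<forall>x\<in>L. \<forall>y\<in>L. x \<bullet> y \<in> \<int>)"

text \<open>For \<open>X = {x\<^sub>1, \<dots>, x\<^sub>k}\<close> this is \<open>L(x\<^sub>1, \<dots>, x\<^sub>k)\<close>.\<close>

definition lattice_adjoin :: "'a::real_vector set \<Rightarrow> 'a set \<Rightarrow> 'a set" where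
  "lattice_adjoin L X = group_closure (L \<union> X)"

definition gram_matrix :: "'a::real_inner ^ 'n \<Rightarrow> real ^ 'n ^ 'n" where
  "gram_matrix e = (\<chi> i j. e $ i \<bullet> e $ j)"

text \<open>
  Only the restriction of \<open>f\<close> to \<open>span L\<close> matters: a linear map on a subspace always extends to the
  whole space, and the extension need not preserve inner products outside \<open>span L\<close>.
\<close>

definition isometric_lattices :: "'a::real_inner set \<Rightarrow> 'b::real_inner set \<Rightarrow> bool" where
  "isometric_lattices L M \<longleftrightarrow>
     (\<exists>f. linear f \<and> (\<forall>x\<in>span L. \<forall>y\<in>span L. f x \<bullet> f y = x \<bullet> y) \<and> f ` L = M)"

end

theory Submission
  imports Defs
begin

text \<open>
  Pairing \<open>x = a e\<^sub>1 + b e\<^sub>2 \<in> M\<close> with \<open>e\<^sub>1\<close>, \<open>e\<^sub>2\<close> gives integers \<open>p = 4a - 2b\<close>, \<open>q = 4b - 2a\<close>, and the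
  norm of \<open>x\<close> is \<open>(p\<^sup>2 + pq + q\<^sup>2)/3\<close>. Its integrality forces \<open>p\<close> and \<open>q\<close> to be congruent modulo 3,
  which says \<open>2a, 2b \<in> \<int>\<close>. So if \<open>M \<noteq> \<Lambda>\<^sub>2\<close>, then \<open>M\<close> contains one of \<open>e\<^sub>1/2\<close>, \<open>e\<^sub>2/2\<close>, \<open>(e\<^sub>1 + e\<^sub>2)/2\<close>.
  The rotation \<open>e\<^sub>1 \<mapsto> e\<^sub>2 \<mapsto> -(e\<^sub>1 + e\<^sub>2) \<mapsto> e\<^sub>1\<close> permutes these up to sign, so some basis
  \<open>d\<^sub>1\<close>, \<open>d\<^sub>2\<close> of \<open>\<Lambda>\<^sub>2\<close> with the same Gram matrix has \<open>d\<^sub>1/2 \<in> M\<close>. Pairing with \<open>d\<^sub>1/2\<close> then shows that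
  the \<open>d\<^sub>2\<close>-coordinates of elements of \<open>M\<close> are integers, whence \<open>M = \<Lambda>\<^sub>2(d\<^sub>1/2)\<close>.
\<close>

text \<open>Explicit integer coordinates for the group generated by a pair, so that membership
  amounts to exhibiting two integers; \<open>group_closure_pair\<close> makes the link.\<close>

definition int_span2 :: "'a::real_vector \<Rightarrow> 'a \<Rightarrow> 'a set" where
  "int_span2 u v = {of_int m *\<^sub>R u + of_int n *\<^sub>R v | m n. True}"

definition additive_subgroup :: "'a::ab_group_add set \<Rightarrow> bool" where
  "additive_subgroup S \<longleftrightarrow> 0 \<in> S \<and> (\<forall>x\<in>S. \<forall>y\<in>S. x - y \<in> S)"

text \<open>The prescribed Gram matrix, entry by entry, for a pair left variable so that rotated
  bases of the same hexagonal lattice qualify too. The Gram determinant is 12.\<close>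

definition hex_basis :: "'a::real_inner \<Rightarrow> 'a \<Rightarrow> bool" where
  "hex_basis u v \<longleftrightarrow> u \<bullet> u = 4 \<and> v \<bullet> v = 4 \<and> u \<bullet> v = -2"

lemma additive_subgroup_group_closure: "additive_subgroup (group_closure S)"
  by (simp add: additive_subgroup_def group_closure.diff)

lemma group_closure_subset:
  assumes "additive_subgroup H" "S \<subseteq> H"
  shows "group_closure S \<subseteq> H"
proof
  fix x assume "x \<in> group_closure S"
  then show "x \<in> H"
    by induction (use assms in \<open>auto simp: additive_subgroup_def\<close>)
qed

lemma additive_subgroup_uminus:
  assumes "additive_subgroup S" "x \<in> S"
  shows "- x \<in> S"
  using assms by (metis additive_subgroup_def diff_0)

lemma additive_subgroup_add:
  assumes "additive_subgroup S" "x \<in> S" "y \<in> S"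
  shows "x + y \<in> S"
  using assms by (metis additive_subgroup_def additive_subgroup_uminus diff_minus_eq_add)

lemma additive_subgroup_of_int_scaleR:
  fixes x :: "'a::real_vector"
  assumes "additive_subgroup S" "x \<in> S"
  shows "of_int k *\<^sub>R x \<in> S"
proof (induction k rule: int_induct[where k = 0])
  case base
  then show ?case using assms by (simp add: additive_subgroup_def)
next
  case (step1 i)
  then show ?case using assms additive_subgroup_add by (fastforce simp: algebra_simps)
next
  case (step2 i)
  then show ?case using assms by (simp add: additive_subgroup_def algebra_simps)
qed

lemma int_span2_subset:
  assumes "additive_subgroup S" "u \<in> S" "v \<in> S"
  shows "int_span2 u v \<subseteq> S"
  using assms
  by (auto simp: int_span2_def intro!: additive_subgroup_add additive_subgroup_of_int_scaleR)

lemma additive_subgroup_int_span2: "additive_subgroup (int_span2 u v)"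
  unfolding additive_subgroup_def
proof (intro conjI ballI)
  show "0 \<in> int_span2 u v"
    unfolding int_span2_def by (rule CollectI, rule exI[of _ 0], rule exI[of _ 0]) simp
next
  fix x y assume "x \<in> int_span2 u v" "y \<in> int_span2 u v"
  then obtain k l m n where
    "x = of_int k *\<^sub>R u + of_int l *\<^sub>R v" "y = of_int m *\<^sub>R u + of_int n *\<^sub>R v"
    unfolding int_span2_def by blast
  then have "x - y = of_int (k - m) *\<^sub>R u + of_int (l - n) *\<^sub>R v"
    by (simp add: algebra_simps)
  then show "x - y \<in> int_span2 u v"
    unfolding int_span2_def by blast
qed

lemma int_span2_generators: "u \<in> int_span2 u v" "v \<in> int_span2 u v"
  unfolding int_span2_def
  by (rule CollectI, rule exI[of _ 1], rule exI[of _ 0], simp)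
     (rule CollectI, rule exI[of _ 0], rule exI[of _ 1], simp)

lemma group_closure_pair: "group_closure {u, v} = int_span2 u v"
proof (rule antisym)
  show "group_closure {u, v} \<subseteq> int_span2 u v"
    by (rule group_closure_subset[OF additive_subgroup_int_span2])
       (simp add: int_span2_generators)
  show "int_span2 u v \<subseteq> group_closure {u, v}"
    by (rule int_span2_subset[OF additive_subgroup_group_closure])
       (auto intro: group_closure.base)
qed

text \<open>As \<open>u\<close> is twice its half, the half replaces \<open>u\<close> as a
  generator. The adjoined lattice is thus again spanned by two vectors, and
  \<open>image_int_span2\<close> applies to it.\<close>

lemma lattice_adjoin_half: "lattice_adjoin (int_span2 u v) {(1/2) *\<^sub>R u} = int_span2 ((1/2) *\<^sub>R u) v"
proof (rule antisym)
  have h: "(1/2) *\<^sub>R u \<in> int_span2 ((1/2) *\<^sub>R u) v" "v \<in> int_span2 ((1/2) *\<^sub>R u) v"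
    by (rule int_span2_generators)+
  have "u \<in> int_span2 ((1/2) *\<^sub>R u) v"
    using additive_subgroup_of_int_scaleR[OF additive_subgroup_int_span2 h(1), of 2] by simp
  then show "lattice_adjoin (int_span2 u v) {(1/2) *\<^sub>R u} \<subseteq> int_span2 ((1/2) *\<^sub>R u) v"
    unfolding lattice_adjoin_def
    by (intro group_closure_subset additive_subgroup_int_span2)
       (use h int_span2_subset[OF additive_subgroup_int_span2] in blast)
  show "int_span2 ((1/2) *\<^sub>R u) v \<subseteq> lattice_adjoin (int_span2 u v) {(1/2) *\<^sub>R u}"
    unfolding lattice_adjoin_def
    by (rule int_span2_subset[OF additive_subgroup_group_closure])
       (auto intro: group_closure.base int_span2_generators)
qed

lemma image_int_span2:
  assumes "linear f"
  shows "f ` int_span2 u v = int_span2 (f u) (f v)"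
proof -
  have "f ` int_span2 u v = {f (of_int m *\<^sub>R u + of_int n *\<^sub>R v) | m n. True}"
    unfolding int_span2_def by blast
  then show ?thesis
    by (simp add: int_span2_def linear_add[OF assms] linear_scale[OF assms])
qed

lemma span_pairE:
  assumes "x \<in> span {u, v}"
  obtains a b where "x = a *\<^sub>R u + b *\<^sub>R v"
proof -
  from assms obtain a b where "x - a *\<^sub>R u = b *\<^sub>R v"
    by (auto simp: span_insert span_breakdown_eq)
  then show thesis
    by (intro that[of a b]) (simp add: algebra_simps)
qed

lemma span_pair_rotate: "span {v, - (u + v)} = span {u, v}"
proof (rule antisym; rule span_minimal[OF _ subspace_span])
  show "{v, - (u + v)} \<subseteq> span {u, v}"
    using span_neg[OF span_add[of u "{u, v}" v]] by (auto intro: span_base)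
  have "- v - (- (u + v)) \<in> span {v, - (u + v)}"
    by (intro span_diff span_neg span_base) auto
  then show "{u, v} \<subseteq> span {v, - (u + v)}"
    by (auto intro: span_base)
qed

text \<open>The vectors \<open>u\<close>, \<open>v\<close>, \<open>- (u + v)\<close> sum to zero,
  have norm 4 and meet pairwise in -2; the lemma is one step of the rotation of order 3 that
  permutes them.\<close>

lemma hex_basis_rotate:
  assumes "hex_basis u v"
  shows "hex_basis v (- (u + v))"
  using assms by (simp add: hex_basis_def inner_simps inner_commute)

lemma hex_basis_isometry:
  fixes u v :: "'a::real_inner" and u' v' :: "'b::real_inner"
  assumes "hex_basis u v" "hex_basis u' v'"
  obtains f where "linear f" "f u = u'" "f v = v'"
    "\<And>x y. x \<in> span {u, v} \<Longrightarrow> y \<in> span {u, v} \<Longrightarrow> f x \<bullet> f y = x \<bullet> y"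
proof -
  \<comment> \<open>The coefficients are the coordinates of the orthogonal projection of
    \<open>x\<close> to the plane of \<open>u\<close> and \<open>v\<close>: the inverse Gram matrix,
    with rows (2, 1)/6 and (1, 2)/6, applied to the pairings with \<open>u\<close> and
    \<open>v\<close>. This makes \<open>f\<close> linear on the whole space.\<close>
  define f where "f x = ((2 * (u \<bullet> x) + v \<bullet> x) / 6) *\<^sub>R u' + ((u \<bullet> x + 2 * (v \<bullet> x)) / 6) *\<^sub>R v'" for x
  have lin: "linear f"
    by (rule linearI) (simp_all add: f_def inner_simps algebra_simps add_divide_distrib)
  have gens: "f u = u'" "f v = v'"
    using assms by (simp_all add: f_def hex_basis_def inner_commute)
  have "f x \<bullet> f y = x \<bullet> y" if x: "x \<in> span {u, v}" and y: "y \<in> span {u, v}" for x y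
  proof -
    from x obtain a b where x: "x = a *\<^sub>R u + b *\<^sub>R v" by (rule span_pairE)
    from y obtain c d where y: "y = c *\<^sub>R u + d *\<^sub>R v" by (rule span_pairE)
    have "f x = a *\<^sub>R u' + b *\<^sub>R v'" "f y = c *\<^sub>R u' + d *\<^sub>R v'"
      by (simp_all add: x y gens linear_add[OF lin] linear_scale[OF lin])
    then show ?thesis
      using assms by (simp add: x y hex_basis_def inner_simps inner_commute)
  qed
  with lin gens show thesis by (rule that)
qed

lemma hex_integral_half:
  assumes hex: "hex_basis u v" and x: "x \<in> span {u, v}"
    and int: "x \<bullet> u \<in> \<int>" "x \<bullet> v \<in> \<int>" "x \<bullet> x \<in> \<int>"
  obtains m n :: int where "x = (of_int m / 2) *\<^sub>R u + (of_int n / 2) *\<^sub>R v"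
proof -
  from x obtain a b where x: "x = a *\<^sub>R u + b *\<^sub>R v" by (rule span_pairE)
  from int obtain p q r :: int where pqr: "x \<bullet> u = p" "x \<bullet> v = q" "x \<bullet> x = r"
    by (auto elim!: Ints_cases)
  have p: "real_of_int p = 4 * a - 2 * b" and q: "real_of_int q = 4 * b - 2 * a"
    and r: "real_of_int r = 4 * a * a - 4 * a * b + 4 * b * b"
    using hex by (simp_all flip: pqr add: x hex_basis_def inner_simps inner_commute algebra_simps)
  \<comment> \<open>The form p^2 + pq + q^2, written as (q - p)^2 + 3pq to expose the square modulo
    3.\<close>
  have "real_of_int (3 * r) = real_of_int ((q - p) * (q - p) + 3 * p * q)"
    by (simp add: p q r algebra_simps)
  then have "3 * r = (q - p) * (q - p) + 3 * (p * q)"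
    by (simp only: of_int_eq_iff mult.assoc)
  then have "(q - p) * (q - p) = 3 * (r - p * q)" by simp
  then have "3 dvd (q - p) * (q - p)" by simp
  then have "3 dvd q - p"
    using prime_dvd_mult_iff[of "3::int" "q - p" "q - p"] by simp
  then obtain k where k: "q - p = 3 * k" ..
  then have "real_of_int q - real_of_int p = 3 * real_of_int k"
    by (metis of_int_diff of_int_mult of_int_numeral)
  \<comment> \<open>Solving for the coordinates gives a = (2p + q)/6 and b = (p + 2q)/6;
    substituting q = p + 3k cancels the factor 3.\<close>
  then have "a = of_int (p + k) / 2" "b = of_int (p + 2 * k) / 2"
    using p q by simp_all
  then show thesis using x that by blast
qed

lemma integral_overlattice_half:
  assumes hex: "hex_basis u v" and M: "additive_subgroup M"
    and int: "\<forall>x\<in>M. \<forall>y\<in>M. x \<bullet> y \<in> \<int>"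
    and sub: "M \<subseteq> span {u, v}" and half: "(1/2) *\<^sub>R u \<in> M" and v: "v \<in> M"
  shows "M = int_span2 ((1/2) *\<^sub>R u) v"
proof
  show "int_span2 ((1/2) *\<^sub>R u) v \<subseteq> M"
    by (rule int_span2_subset[OF M half v])
  show "M \<subseteq> int_span2 ((1/2) *\<^sub>R u) v"
  proof
    fix x assume x: "x \<in> M"
    have u: "u \<in> M"
      using additive_subgroup_of_int_scaleR[OF M half, of 2] by simp
    obtain m n :: int where mn: "x = (of_int m / 2) *\<^sub>R u + (of_int n / 2) *\<^sub>R v"
      using hex_integral_half[OF hex, of x] int sub x u v by blast
    have "x \<bullet> ((1/2) *\<^sub>R u) \<in> \<int>" using int x half by blast
    then obtain r :: int where "x \<bullet> ((1/2) *\<^sub>R u) = r" by (auto elim: Ints_cases)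
    \<comment> \<open>The pairing equals m - n/2, so \<open>n\<close> is even, while
      \<open>m\<close> stays arbitrary.\<close>
    then have "real_of_int n = 2 * (of_int m - of_int r)"
      using hex by (simp add: mn hex_basis_def inner_simps inner_commute field_simps)
    then have "x = of_int m *\<^sub>R ((1/2) *\<^sub>R u) + of_int (m - r) *\<^sub>R v"
      by (simp add: mn)
    then show "x \<in> int_span2 ((1/2) *\<^sub>R u) v"
      unfolding int_span2_def by blast
  qed
qed

text \<open>The isometry taking \<open>d1\<close>, \<open>d2\<close> to \<open>e1\<close>,
  \<open>e2\<close> carries \<open>M\<close> to the one standard overlattice, whichever half vector
  \<open>M\<close> contains.\<close>

lemma integral_overlattice_isometric:
  assumes e: "hex_basis e1 e2" and d: "hex_basis d1 d2" and M: "additive_subgroup M"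
    and int: "\<forall>x\<in>M. \<forall>y\<in>M. x \<bullet> y \<in> \<int>"
    and sub: "M \<subseteq> span {d1, d2}" and half: "(1/2) *\<^sub>R d1 \<in> M" and d2: "d2 \<in> M"
  shows "isometric_lattices M (lattice_adjoin (int_span2 e1 e2) {(1/2) *\<^sub>R e1})"
proof -
  obtain f where lin: "linear f" and f: "f d1 = e1" "f d2 = e2"
    and iso: "\<And>x y. x \<in> span {d1, d2} \<Longrightarrow> y \<in> span {d1, d2} \<Longrightarrow> f x \<bullet> f y = x \<bullet> y"
    using hex_basis_isometry[OF d e] by blast
  have "f ` M = lattice_adjoin (int_span2 e1 e2) {(1/2) *\<^sub>R e1}"
    by (simp add: integral_overlattice_half[OF d M int sub half d2] image_int_span2[OF lin]
        lattice_adjoin_half linear_scale[OF lin] f)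
  moreover have "span M \<subseteq> span {d1, d2}"
    using sub by (simp add: span_minimal)
  ultimately show ?thesis
    unfolding isometric_lattices_def using lin iso by blast
qed

lemma isometric_lattices_refl: "isometric_lattices L L"
  unfolding isometric_lattices_def by (rule exI[of _ id]) (simp add: linear_id)

theorem theorem3p1:
  fixes e1 e2 :: "'a::real_inner" and \<Lambda>2 M :: "'a set"
  assumes "lattice_basis {e1, e2} \<Lambda>2"
    and "gram_matrix (vector [e1, e2] :: 'a ^ 2) =
           2 *\<^sub>R (vector [vector [2, -1], vector [-1, 2]] :: real ^ 2 ^ 2)"
    and "integral_lattice M"
    and "M \<subseteq> span \<Lambda>2"
    and "\<Lambda>2 \<subseteq> M"
  shows "isometric_lattices M \<Lambda>2 \<or>
         isometric_lattices M (lattice_adjoin \<Lambda>2 {(1/2) *\<^sub>R e1})"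
proof (cases "M = \<Lambda>2")
  case True
  then show ?thesis by (simp add: isometric_lattices_refl)
next
  case False
  have \<Lambda>: "\<Lambda>2 = int_span2 e1 e2"
    using assms(1) by (simp add: lattice_basis_def group_closure_pair)
  have e: "hex_basis e1 e2"
    using assms(2) by (simp add: hex_basis_def gram_matrix_def vec_eq_iff forall_2)
  have M: "additive_subgroup M"
    using assms(3) additive_subgroup_group_closure
    by (auto simp: integral_lattice_def is_lattice_def lattice_basis_def)
  have int: "\<forall>x\<in>M. \<forall>y\<in>M. x \<bullet> y \<in> \<int>"
    using assms(3) by (simp add: integral_lattice_def)
  have e1: "e1 \<in> M" and e2: "e2 \<in> M"
    using assms(5) int_span2_generators unfolding \<Lambda> by blast+
  have "\<Lambda>2 \<subseteq> span {e1, e2}"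
    unfolding \<Lambda>
    by (rule int_span2_subset) (auto simp: additive_subgroup_def span_zero span_diff intro: span_base)
  then have sub: "M \<subseteq> span {e1, e2}"
    using assms(4) by (metis span_minimal subspace_span subset_trans)
  from False assms(5) obtain x where x: "x \<in> M" "x \<notin> \<Lambda>2" by blast
  obtain m n :: int where mn: "x = (of_int m / 2) *\<^sub>R e1 + (of_int n / 2) *\<^sub>R e2"
    using hex_integral_half[OF e, of x] int sub x(1) e1 e2 by blast
  \<comment> \<open>Subtracting a vector of \<open>\<Lambda>2\<close> leaves coordinates 0 or 1/2,
    determined by the parities of \<open>m\<close> and \<open>n\<close>.\<close>
  have reduced: "(of_int (m mod 2) / 2) *\<^sub>R e1 + (of_int (n mod 2) / 2) *\<^sub>R e2 \<in> M"
    (is "?y \<in> M")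
  proof -
    have half: "real_of_int k / 2 = of_int (k mod 2) / 2 + of_int (k div 2)" for k :: int
      by (simp add: minus_mult_div_eq_mod[symmetric] diff_divide_distrib)
    have "?y = x - (of_int (m div 2) *\<^sub>R e1 + of_int (n div 2) *\<^sub>R e2)"
      unfolding mn half[of m] half[of n] by (simp add: scaleR_add_left)
    then show ?thesis
      using M x(1) assms(5) unfolding \<Lambda> additive_subgroup_def int_span2_def by auto
  qed
  have "\<not> (even m \<and> even n)"
  proof
    assume "even m \<and> even n"
    then obtain k l where "m = 2 * k" "n = 2 * l" by (auto elim!: evenE)
    then have "x = of_int k *\<^sub>R e1 + of_int l *\<^sub>R e2" by (simp add: mn)
    then show False using x(2) unfolding \<Lambda> int_span2_def by blast
  qed
  then consider "odd m" "even n" | "even m" "odd n" | "odd m" "odd n" by blast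
  \<comment> \<open>The parity cases take \<open>d1\<close> to be \<open>e1\<close>,
    \<open>e2\<close> and \<open>- (e1 + e2)\<close>: the given basis rotated zero, one and two
    times.\<close>
  then have "\<exists>d1 d2. hex_basis d1 d2 \<and> span {d1, d2} = span {e1, e2} \<and> (1/2) *\<^sub>R d1 \<in> M \<and> d2 \<in> M"
  proof cases
    case 1
    then have "(1/2) *\<^sub>R e1 \<in> M"
      using reduced by (simp add: odd_iff_mod_2_eq_one even_iff_mod_2_eq_zero)
    then show ?thesis using e e2 by blast
  next
    case 2
    then have "(1/2) *\<^sub>R e2 \<in> M"
      using reduced by (simp add: odd_iff_mod_2_eq_one even_iff_mod_2_eq_zero)
    moreover have "- (e1 + e2) \<in> M"
      using M e1 e2 by (intro additive_subgroup_uminus additive_subgroup_add)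
    moreover have "span {e2, - (e1 + e2)} = span {e1, e2}"
      by (rule span_pair_rotate)
    ultimately show ?thesis using hex_basis_rotate[OF e] by blast
  next
    case 3
    then have "(1/2) *\<^sub>R e1 + (1/2) *\<^sub>R e2 \<in> M"
      using reduced by (simp add: odd_iff_mod_2_eq_one)
    then have "(1/2) *\<^sub>R (- (e1 + e2)) \<in> M"
      using additive_subgroup_uminus[OF M] by (fastforce simp: algebra_simps)
    \<comment> \<open>The second rotation produces - (e2 - (e1 + e2)), which is
      \<open>e1\<close>.\<close>
    moreover have "hex_basis (- (e1 + e2)) e1"
      using hex_basis_rotate[OF hex_basis_rotate[OF e]] by simp
    moreover have "span {- (e1 + e2), e1} = span {e1, e2}"
      using span_pair_rotate[of e2 e1] span_pair_rotate[of "- (e1 + e2)" e2] by simp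
    ultimately show ?thesis using e1 by blast
  qed
  then show ?thesis
    unfolding \<Lambda> using integral_overlattice_isometric[OF e _ M int] sub by metis
qed

end
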